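(* (a) For two matrices $A,B\in\mathbb{R}^{m\times n}$ exactly one of the following two statements is true: 1. There is a solution $\vec x\in\mathbb{R}^n$ to $A\odot\vec x\le B\odot\vec x$. 2. There is a solution $\vec y\in\mathbb{R}^m$ to $B^T\odot\vec y<A^T\odot\vec y$. (b) For two matrices $A,B\in\mathbb{R}_\infty^{m\times n}$ such that no row index and no column index corresponds to a row (respectively column) consisting entirely of $\infty$ in both $A$ and $B$, exactly one of the following two statements is true: 1. There is a solution $\vec x\in\mathbb{R}_\infty^n$, $\vec x\ne(\infty,\dots,\infty)$, to $A\odot\vec x\le B\odot\vec x$. 2. There is a finite solution $\vec y\in\mathbb{R}^m$ to $B^T\odot\vec y<A^T\odot\vec y$. (c) For two matrices $A,B\in\mathbb{R}_\infty^{m\times n}$ such that no row index and no column index corresponds to a row (respectively column) consisting entirely of $\infty$ in both $A$ and $B$, exactly one of the following two statements is true: 1. There is a finite solution $\vec x\in\mathbb{R}^n$ to $A\odot\vec x\le B\odot\vec x$. 2. There is a solution $\vec y\in\mathbb{R}_\infty^m$, $\vec y\ne(\infty,\dots,\infty)$, to $B^T\odot\vec y<A^T\odot\vec y$.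
   Context: $\mathbb{R}_\infty=\mathbb{R}\cup\{+\infty\}$. For a matrix $A=(a_{ij})\in\mathbb{R}_\infty^{m\times n}$ ($m,n\ge1$) and $\vec x\in\mathbb{R}_\infty^n$, $A\odot\vec x$ is the vector in $\mathbb{R}_\infty^m$ with $i$-th coordinate $\min_j(a_{ij}+x_j)$. Inequalities between vectors are componentwise. Convention for strict inequalities: $\vec y$ is a solution of $C\odot\vec y<D\odot\vec y$ if for each row, either both sides are equal to $\infty$, or the strict inequality holds (i.e. "$\infty<\infty$" is allowed). *)

theory Defs
  imports "HOL-Analysis.Analysis" "HOL-Library.Extended_Real"
begin

definition R_inf :: "ereal set" where
  "R_inf = range ereal \<union> {\<infinity>}"

definition R_inf_vec :: "(ereal ^ 'n) set" where
  "R_inf_vec = {x. \<forall>j. x $ j \<in> R_inf}"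

definition R_inf_mat :: "(ereal ^ 'n ^ 'm) set" where
  "R_inf_mat = {A. \<forall>i j. A $ i $ j \<in> R_inf}"

definition inf_vec :: "ereal ^ 'n" where
  "inf_vec = (\<chi> j. \<infinity>)"

definition ereal_vec :: "real ^ 'n \<Rightarrow> ereal ^ 'n" where
  "ereal_vec x = (\<chi> j. ereal (x $ j))"

text \<open>The min-plus product, polymorphic so that it serves both the reals and the extended reals.
  The minimum ranges over a finite nonempty set because the index type is finite.\<close>

definition trop_mult :: "'a::{linorder,plus} ^ 'n ^ 'm \<Rightarrow> 'a ^ 'n \<Rightarrow> 'a ^ 'm"
    (infixr "\<odot>" 75) where
  "A \<odot> x = (\<chi> i. Min (range (\<lambda>j. A $ i $ j + x $ j)))"

text \<open>Componentwise strict inequality. The library order \<open><\<close> on vectors is not componentwise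
  (it means \<open>\<le>\<close> but not \<open>\<ge>\<close>), whereas \<open>\<le>\<close> is.  For extended real vectors
  a component with both sides equal to \<open>\<infinity>\<close> also counts as satisfied.\<close>

definition vec_less :: "real ^ 'n \<Rightarrow> real ^ 'n \<Rightarrow> bool" where
  "vec_less u v \<longleftrightarrow> (\<forall>i. u $ i < v $ i)"

definition vec_less_inf :: "ereal ^ 'n \<Rightarrow> ereal ^ 'n \<Rightarrow> bool" where
  "vec_less_inf u v \<longleftrightarrow> (\<forall>i. (u $ i = \<infinity> \<and> v $ i = \<infinity>) \<or> u $ i < v $ i)"

definition no_common_inf_row :: "ereal ^ 'n ^ 'm \<Rightarrow> ereal ^ 'n ^ 'm \<Rightarrow> bool" where
  "no_common_inf_row A B \<longleftrightarrow> \<not> (\<exists>i. \<forall>j. A $ i $ j = \<infinity> \<and> B $ i $ j = \<infinity>)"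

definition no_common_inf_column :: "ereal ^ 'n ^ 'm \<Rightarrow> ereal ^ 'n ^ 'm \<Rightarrow> bool" where
  "no_common_inf_column A B \<longleftrightarrow> \<not> (\<exists>j. \<forall>i. A $ i $ j = \<infinity> \<and> B $ i $ j = \<infinity>)"

end

theory Submission
  imports Defs
begin

text \<open>
  The two alternatives exclude each other because the bilinear form
  \<open>min over i, j of y\<^sub>i + b\<^sub>i\<^sub>j + x\<^sub>j\<close> can be evaluated in two orders. If \<open>x\<close> solves the weak system,
  replacing \<open>B\<close> by \<open>A\<close> does not increase its value; if \<open>y\<close> solves the strict dual system,
  replacing \<open>B\<close> by \<open>A\<close> increases it, unless the value is \<open>\<infinity>\<close>. So the value is \<open>\<infinity>\<close>
  (\<open>weak_and_dual_strict_imp_infinite\<close>). As one of the two solutions is finite and the other has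
  a finite entry, this makes a whole row or a whole column infinite in both matrices.

  That one of the alternatives holds starts from the case where \<open>A\<close> is finite and every column of
  \<open>B\<close> has a finite entry. The weak system then reads \<open>T x \<le> x\<close> for the map
  \<open>T x\<^sub>j = max\<^sub>i (min\<^sub>k (a\<^sub>i\<^sub>k + x\<^sub>k) - b\<^sub>i\<^sub>j)\<close>. This map has an additive eigenvector, \<open>T x = x + \<mu>\<close>,
  by Brouwer's theorem (\<open>max_min_eigenvector\<close>). If \<open>\<mu> \<le> 0\<close> then \<open>x\<close> solves the weak system,
  and if \<open>\<mu> > 0\<close> then \<open>y = - (A \<odot> x)\<close> solves the strict dual system (\<open>finite_alternative\<close>).

  For infinite entries of \<open>A\<close>, replace each \<open>\<infinity>\<close> in \<open>A\<close> by \<open>n\<close>. A finite dual solution for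
  some \<open>n\<close> is still one for \<open>A\<close>, since only the larger side grows. Otherwise there are weak
  solutions \<open>x\<^sub>n\<close> for all \<open>n\<close>; normalised to minimum \<open>0\<close> they have a cluster point in
  \<open>[0, \<infinity>]\<^sup>n\<close>, which solves the weak system and has a finite entry (\<open>weak_or_dual_strict\<close>). This is
  where infinite coordinates of \<open>x\<close> arise.

  For finite \<open>x\<close> and possibly infinite \<open>y\<close>, this result is applied to the transposed pair with
  \<open>B + \<epsilon>\<close> in place of \<open>B\<close>. The summand \<open>\<epsilon>\<close> turns the weak dual inequality into the strict
  one, so that without a strict dual solution there are, for every \<open>\<epsilon> > 0\<close>, finite \<open>x\<close> with
  \<open>A \<odot> x \<le> (B + \<epsilon>) \<odot> x\<close>. These may be unbounded even modulo constants, and yet a finite solution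
  for \<open>\<epsilon> = 0\<close> exists (\<open>minplus_le_of_approx\<close>).
\<close>

section \<open>Min-plus inequalities without minima\<close>

text \<open>Indexing by two arguments instead of by vectors of vectors makes transposition an exchange of
  arguments, and the quantifiers below spare all arithmetic with minima. The minimum on the
  smaller side becomes an existential quantifier, that on the larger side a universal one.\<close>

definition minplus_le :: "('i \<Rightarrow> 'j \<Rightarrow> 'a::{linorder,plus}) \<Rightarrow> ('i \<Rightarrow> 'j \<Rightarrow> 'a) \<Rightarrow> ('j \<Rightarrow> 'a) \<Rightarrow> bool" where
  "minplus_le a b x \<longleftrightarrow> (\<forall>i j. \<exists>k. a i k + x k \<le> b i j + x j)"

definition minplus_less :: "('i \<Rightarrow> 'j \<Rightarrow> 'a::{linorder,plus}) \<Rightarrow> ('i \<Rightarrow> 'j \<Rightarrow> 'a) \<Rightarrow> ('j \<Rightarrow> 'a) \<Rightarrow> bool" where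
  "minplus_less a b x \<longleftrightarrow> (\<forall>i. \<exists>k. \<forall>j. a i k + x k < b i j + x j)"

definition minplus_less_inf :: "('i \<Rightarrow> 'j \<Rightarrow> ereal) \<Rightarrow> ('i \<Rightarrow> 'j \<Rightarrow> ereal) \<Rightarrow> ('j \<Rightarrow> ereal) \<Rightarrow> bool" where
  "minplus_less_inf a b x \<longleftrightarrow>
    (\<forall>i. (\<forall>j. a i j + x j = \<infinity> \<and> b i j + x j = \<infinity>) \<or> (\<exists>k. \<forall>j. a i k + x k < b i j + x j))"

lemma trop_mult_le_iff:
  fixes A B :: "'a::{linorder,plus} ^ 'n ^ 'm"
  shows "A \<odot> x \<le> B \<odot> x \<longleftrightarrow>
    minplus_le (\<lambda>i j. A $ i $ j) (\<lambda>i j. B $ i $ j) (\<lambda>j. x $ j)"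
  by (simp add: less_eq_vec_def trop_mult_def minplus_le_def Min_le_iff)

lemma Min_range_less_Min_range_iff:
  fixes f g :: "'n::finite \<Rightarrow> 'a::linorder"
  shows "Min (range f) < Min (range g) \<longleftrightarrow> (\<exists>k. \<forall>j. f k < g j)"
proof
  assume less: "Min (range f) < Min (range g)"
  have "Min (range f) \<in> range f"
    by (rule Min_in) auto
  then obtain k where "Min (range f) = f k" by (rule imageE)
  then show "\<exists>k. \<forall>j. f k < g j"
    using less by auto
qed (auto simp: Min_less_iff Min_gr_iff)

lemma vec_less_trop_mult_iff:
  "vec_less (A \<odot> x) (B \<odot> x) \<longleftrightarrow>
    minplus_less (\<lambda>i j. A $ i $ j) (\<lambda>i j. B $ i $ j) (\<lambda>j. x $ j)"
  by (simp add: vec_less_def trop_mult_def minplus_less_def Min_range_less_Min_range_iff)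

lemma Min_range_eq_infinity_iff:
  fixes f :: "'n::finite \<Rightarrow> ereal"
  shows "Min (range f) = \<infinity> \<longleftrightarrow> (\<forall>j. f j = \<infinity>)"
proof -
  have "\<infinity> \<le> Min (range f) \<longleftrightarrow> (\<forall>j. \<infinity> \<le> f j)"
    by (subst Min_ge_iff) auto
  then show ?thesis
    by (simp only: ereal_infty_less_eq(1))
qed

lemma vec_less_inf_trop_mult_iff:
  "vec_less_inf (A \<odot> x) (B \<odot> x) \<longleftrightarrow>
    minplus_less_inf (\<lambda>i j. A $ i $ j) (\<lambda>i j. B $ i $ j) (\<lambda>j. x $ j)"
  by (simp add: vec_less_inf_def trop_mult_def minplus_less_inf_def Min_range_less_Min_range_iff
      Min_range_eq_infinity_iff all_conj_distrib)

section \<open>The alternative for finite matrices\<close>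

lemma continuous_on_Max:
  fixes f :: "'i \<Rightarrow> 'a::topological_space \<Rightarrow> 'b::linorder_topology"
  assumes "finite S" "S \<noteq> {}" "\<And>i. i \<in> S \<Longrightarrow> continuous_on X (f i)"
  shows "continuous_on X (\<lambda>x. Max ((\<lambda>i. f i x) ` S))"
  using assms
proof (induction S rule: finite_ne_induct)
  case (insert i S)
  then show ?case by (simp add: continuous_on_max)
qed auto

lemma continuous_on_Min:
  fixes f :: "'i \<Rightarrow> 'a::topological_space \<Rightarrow> 'b::linorder_topology"
  assumes "finite S" "S \<noteq> {}" "\<And>i. i \<in> S \<Longrightarrow> continuous_on X (f i)"
  shows "continuous_on X (\<lambda>x. Min ((\<lambda>i. f i x) ` S))"
  using assms
proof (induction S rule: finite_ne_induct)
  case (insert i S)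
  then show ?case by (simp add: continuous_on_min)
qed auto

text \<open>Coordinates of \<open>T x\<close> differ by a bounded amount that does not depend on \<open>x\<close>: the inner minima
  over the rows of the finite matrix \<open>a\<close> differ by at most \<open>2 * D\<close>, where \<open>D\<close> bounds all entries.
  So, after one coordinate of \<open>T x\<close> is normalised to \<open>0\<close>, the map sends everything into a
  cube and has a fixed point there. The set \<open>S j\<close> stands for the finite entries in column \<open>j\<close>
  of the second matrix.\<close>

lemma max_min_eigenvector:
  fixes a b :: "'m::finite \<Rightarrow> 'n::finite \<Rightarrow> real"
  assumes S: "\<And>j. S j \<noteq> {}"
  shows "\<exists>x \<mu>. \<forall>j. Max ((\<lambda>i. Min (range (\<lambda>k. a i k + x k)) - b i j) ` S j) = x j + \<mu>"
proof -
  define z where "z x i = Min (range (\<lambda>k. a i k + x $ k))" for x :: "real ^ 'n" and i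
  define T where "T x j = Max ((\<lambda>i. z x i - b i j) ` S j)" for x j
  define j0 :: 'n where "j0 = undefined"
  define N where "N x = (\<chi> j. T x j - T x j0)" for x
  define D where "D = Max (range (\<lambda>(i, j). max \<bar>a i j\<bar> \<bar>b i j\<bar>))"
  have "max \<bar>a i j\<bar> \<bar>b i j\<bar> \<le> D" for i j
    unfolding D_def by (rule Max_ge) auto
  then have D: "\<bar>a i j\<bar> \<le> D" "\<bar>b i j\<bar> \<le> D" for i j
    by (simp_all add: max.bounded_iff)
  have z_le: "z x i \<le> z x i' + 2 * D" for x i i'
  proof -
    have "z x i' \<in> range (\<lambda>k. a i' k + x $ k)"
      unfolding z_def by (rule Min_in) auto
    then obtain k where "z x i' = a i' k + x $ k" by auto
    moreover have "z x i \<le> a i k + x $ k"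
      unfolding z_def by (rule Min_le) auto
    ultimately show ?thesis
      using D(1)[of i k] D(1)[of i' k] by linarith
  qed
  have T_le: "T x j \<le> T x j' + 4 * D" for x j j'
  proof -
    have "T x j \<in> (\<lambda>i. z x i - b i j) ` S j"
      unfolding T_def using S by (intro Max_in) auto
    then obtain i where i: "T x j = z x i - b i j" by auto
    obtain i' where "i' \<in> S j'" using S by blast
    then have "z x i' - b i' j' \<le> T x j'"
      unfolding T_def by (intro Max_ge) auto
    then show ?thesis
      using i z_le[of x i i'] D(2)[of i j] D(2)[of i' j'] by linarith
  qed
  have cont: "continuous_on X N" for X
    unfolding N_def T_def z_def
    by (intro continuous_on_vec_lambda continuous_on_diff continuous_on_Max continuous_on_Min
        continuous_intros) (use S in auto)
  have "0 \<le> D" using D(1)[of undefined undefined] by linarith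
  then obtain x where x: "N x = x"
  proof (rule_tac brouwer[of "cbox (\<chi> j. - 4 * D) (\<chi> j. 4 * D)" N])
    show "N \<in> cbox (\<chi> j. - 4 * D) (\<chi> j. 4 * D) \<rightarrow> cbox (\<chi> j. - 4 * D) (\<chi> j. 4 * D)"
      using T_le by (auto simp: mem_box_cart N_def algebra_simps)
  qed (auto simp: cont interval_eq_empty_cart intro: that)
  have "T x j = x $ j + T x j0" for j
    using arg_cong[OF x, of "\<lambda>v. v $ j"] by (simp add: N_def)
  then have "\<forall>j. Max ((\<lambda>i. Min (range (\<lambda>k. a i k + x $ k)) - b i j) ` S j) = x $ j + T x j0"
    unfolding T_def z_def by blast
  then show ?thesis
    by (intro exI[of _ "\<lambda>j. x $ j"] exI[of _ "T x j0"])
qed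

text \<open>The sign of the eigenvalue \<open>\<mu>\<close> decides. For \<open>\<mu> \<le> 0\<close> the eigenvector satisfies \<open>T x \<le> x\<close>.
  For \<open>\<mu> > 0\<close> and \<open>y = - z\<close>, where \<open>z\<close> is the min-plus product of \<open>a\<close> and \<open>x\<close>, the eigenvalue
  equation says that the minimum of \<open>b i j + y i\<close> over \<open>S j\<close> is \<open>- x j - \<mu>\<close>, while
  \<open>a k j + y k \<ge> - x j\<close> for all \<open>k\<close>.\<close>

lemma finite_alternative:
  fixes a b :: "'m::finite \<Rightarrow> 'n::finite \<Rightarrow> real"
  assumes S: "\<And>j. S j \<noteq> {}"
  shows "(\<exists>x. \<forall>i j. i \<in> S j \<longrightarrow> (\<exists>k. a i k + x k \<le> b i j + x j)) \<or>
    (\<exists>y. \<forall>j. \<exists>i\<in>S j. \<forall>k. b i j + y i < a k j + y k)"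
proof -
  obtain x \<mu> where
    x: "\<forall>j. Max ((\<lambda>i. Min (range (\<lambda>k. a i k + x k)) - b i j) ` S j) = x j + \<mu>"
    using max_min_eigenvector[where S = S and a = a and b = b, OF S] by (elim exE)
  define z where "z i = Min (range (\<lambda>k. a i k + x k))" for i
  have eig: "Max ((\<lambda>i. z i - b i j) ` S j) = x j + \<mu>" for j
    using x by (simp add: z_def)
  show ?thesis
  proof (cases "\<mu> \<le> 0")
    case True
    have "\<exists>k. a i k + x k \<le> b i j + x j" if "i \<in> S j" for i j
    proof -
      have "z i - b i j \<le> x j + \<mu>"
        using that unfolding eig[symmetric] by (intro Max_ge) auto
      moreover have "z i \<in> range (\<lambda>k. a i k + x k)"
        unfolding z_def by (rule Min_in) auto
      then obtain k where "z i = a i k + x k" by (rule imageE)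
      ultimately have "a i k + x k \<le> b i j + x j"
        using True by linarith
      then show ?thesis by blast
    qed
    then show ?thesis by blast
  next
    case False
    have "\<exists>i\<in>S j. \<forall>k. b i j + - z i < a k j + - z k" for j
    proof -
      have "x j + \<mu> \<in> (\<lambda>i. z i - b i j) ` S j"
        unfolding eig[symmetric] using S by (intro Max_in) auto
      then obtain i where i: "i \<in> S j" "x j + \<mu> = z i - b i j" by auto
      have "b i j + - z i < a k j + - z k" for k
      proof -
        have "z k \<le> a k j + x j"
          unfolding z_def by (rule Min_le) auto
        then show ?thesis using i(2) False by linarith
      qed
      then show ?thesis
        using i(1) by blast
    qed
    then show ?thesis by (intro disjI2 exI[of _ "\<lambda>i. - z i"] allI)
  qed
qed

section \<open>Exclusiveness\<close>

text \<open>Were the form finite somewhere, take a position \<open>(i0, j0)\<close> where it attains its minimum \<open>m\<close>.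
  The weak inequality in row \<open>i0\<close> passes to an entry of \<open>a\<close> with value at most \<open>m\<close>, and the strict one
  in the column of that entry goes back to an entry of \<open>b\<close> with value below \<open>m\<close>.\<close>

lemma weak_and_dual_strict_imp_infinite:
  fixes a b :: "'m::finite \<Rightarrow> 'n::finite \<Rightarrow> ereal"
  assumes le: "minplus_le a b x"
    and less: "minplus_less_inf (\<lambda>j i. b i j) (\<lambda>j i. a i j) y"
    and fin: "\<And>i j. a i j \<noteq> -\<infinity>" "\<And>i j. b i j \<noteq> -\<infinity>" "\<And>j. x j \<noteq> -\<infinity>" "\<And>i. y i \<noteq> -\<infinity>"
  shows "b i j + x j + y i = \<infinity>"
proof (rule ccontr)
  assume not_inf: "b i j + x j + y i \<noteq> \<infinity>"
  define f where "f = (\<lambda>(i, j). b i j + x j + y i)"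
  define m where "m = Min (range f)"
  have m_le: "m \<le> b i j + x j + y i" for i j
    unfolding m_def by (rule Min_le) (auto simp: f_def)
  have "m \<in> range f"
    unfolding m_def by (rule Min_in) auto
  then obtain i0 j0 where m: "m = b i0 j0 + x j0 + y i0"
    by (auto simp: f_def)
  have "m \<noteq> \<infinity>"
    using m_le[of i j] not_inf by auto
  obtain k where k: "a i0 k + x k \<le> b i0 j0 + x j0"
    using le by (auto simp: minplus_le_def)
  have "a i0 k + x k + y i0 \<noteq> \<infinity>"
    using add_right_mono[OF k, of "y i0"] \<open>m \<noteq> \<infinity>\<close> m by auto
  then obtain i where i: "b i k + y i < a i0 k + y i0"
    using less by (fastforce simp: minplus_less_inf_def)
  have "b i k + x k + y i < a i0 k + x k + y i0"
    using i \<open>a i0 k + x k + y i0 \<noteq> \<infinity>\<close> fin(3)[of k]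
    by (cases "x k"; cases "a i0 k"; cases "b i k"; cases "y i"; cases "y i0") auto
  also have "\<dots> \<le> m"
    using add_right_mono[OF k, of "y i0"] m by simp
  also have "\<dots> \<le> b i k + x k + y i" by (rule m_le)
  finally show False by simp
qed

section \<open>Infinite entries by compactness\<close>

lemma ereal_family_convergent_subseq:
  fixes X :: "nat \<Rightarrow> 'i::finite \<Rightarrow> ereal"
  obtains r l where "strict_mono (r :: nat \<Rightarrow> nat)" "\<And>i. (\<lambda>n. X (r n) i) \<longlonglongrightarrow> l i"
proof -
  have "\<exists>r l. strict_mono (r :: nat \<Rightarrow> nat) \<and> (\<forall>i\<in>F. (\<lambda>n. X (r n) i) \<longlonglongrightarrow> l i)"
    if "finite F" for F
    using that
  proof (induction F rule: finite_induct)
    case empty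
    show ?case using strict_mono_id by auto
  next
    case (insert i F)
    then obtain r l where r: "strict_mono r" "\<forall>i\<in>F. (\<lambda>n. X (r n) i) \<longlonglongrightarrow> l i" by blast
    obtain s c where s: "strict_mono s" "((\<lambda>n. X (r n) i) \<circ> s) \<longlonglongrightarrow> c"
      using compact_complete_linorder by metis
    have "(\<lambda>n. X ((r \<circ> s) n) i') \<longlonglongrightarrow> (l(i := c)) i'" if "i' \<in> insert i F" for i'
      using that r(2) s LIMSEQ_subseq_LIMSEQ[of "\<lambda>n. X (r n) i'" "l i'" s]
      by (auto simp: o_def)
    then show ?case
      using strict_mono_o[OF r(1) s(1)] by blast
  qed
  from this[of UNIV] that show thesis by auto
qed

lemma eventually_less_of_tendsto_less:
  fixes f g :: "'a \<Rightarrow> 'b::{dense_linorder,linorder_topology}"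
  assumes "(f \<longlongrightarrow> l) F" "(g \<longlongrightarrow> m) F" "l < m"
  shows "eventually (\<lambda>x. f x < g x) F"
proof -
  obtain c where "l < c" "c < m" using dense[OF assms(3)] by blast
  then have "eventually (\<lambda>x. f x < c) F" "eventually (\<lambda>x. c < g x) F"
    using assms order_tendstoD by blast+
  then show ?thesis by eventually_elim auto
qed


text \<open>The limit argument with each \<open>\<infinity>\<close> in \<open>a\<close> replaced by \<open>n\<close>. It needs a finite entry in every
  column of \<open>b\<close>; if column \<open>j\<close> of \<open>b\<close> is infinite, the vector with \<open>0\<close> at \<open>j\<close> and \<open>\<infinity>\<close>
  elsewhere makes the larger side infinite and so is a weak solution.\<close>

lemma weak_or_dual_strict:
  fixes a b :: "'m::finite \<Rightarrow> 'n::finite \<Rightarrow> ereal"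
  assumes fin: "\<And>i j. a i j \<noteq> -\<infinity>" "\<And>i j. b i j \<noteq> -\<infinity>"
    and no_y: "\<nexists>y :: 'm \<Rightarrow> real. minplus_less (\<lambda>j i. b i j) (\<lambda>j i. a i j) (\<lambda>i. ereal (y i))"
  obtains x j where "\<And>k. x k \<noteq> -\<infinity>" "x j \<noteq> \<infinity>" "minplus_le a b x"
proof (cases "\<exists>j. \<forall>i. b i j = \<infinity>")
  case True
  then obtain j where j: "\<And>i. b i j = \<infinity>" by auto
  have "b i j' + (if j' = j then 0 else \<infinity>) = \<infinity>" for i j'
    using j fin(2)[of i j'] by auto
  then have "minplus_le a b (\<lambda>k. if k = j then 0 else \<infinity>)"
    by (simp only: minplus_le_def) simp
  then show thesis
    using that[of "\<lambda>k. if k = j then 0 else \<infinity>" j] by auto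
next
  case False
  define an where "an n i k = (if a i k = \<infinity> then real n else real_of_ereal (a i k))" for n i k
  define br where "br i j = real_of_ereal (b i j)" for i j
  have br: "b i j = ereal (br i j)" if "b i j \<noteq> \<infinity>" for i j
    using that fin(2)[of i j] by (cases "b i j") (auto simp: br_def)
  have an_le: "ereal (an n i k) \<le> a i k" for n i k
    using fin(1)[of i k] by (cases "a i k") (auto simp: an_def)
  have an_lim: "(\<lambda>n. ereal (an n i k)) \<longlonglongrightarrow> a i k" for i k
    using fin(1)[of i k] id_nat_ereal_tendsto_PInf
    by (cases "a i k") (auto simp: an_def)
  have "\<exists>x. (\<forall>j. 0 \<le> x j) \<and> (\<exists>j. x j = 0) \<and>
      (\<forall>i j. b i j \<noteq> \<infinity> \<longrightarrow> (\<exists>k. an n i k + x k \<le> br i j + x j))" for n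
  proof -
    have "{i. b i j \<noteq> \<infinity>} \<noteq> {}" for j
      using False by auto
    then consider x where "\<And>i j. b i j \<noteq> \<infinity> \<Longrightarrow> \<exists>k. an n i k + x k \<le> br i j + x j"
      | y where "\<And>j. \<exists>i. b i j \<noteq> \<infinity> \<and> (\<forall>k. br i j + y i < an n k j + y k)"
      using finite_alternative[of "\<lambda>j. {i. b i j \<noteq> \<infinity>}" "an n" br] by blast
    then show ?thesis
    proof cases
      case (1 x)
      define m where "m = Min (range x)"
      have "m \<in> range x"
        unfolding m_def by (rule Min_in) auto
      then obtain j where "x j - m = 0" by auto
      moreover have "0 \<le> x j - m" for j
        unfolding m_def by simp
      moreover have "\<exists>k. an n i k + (x k - m) \<le> br i j + (x j - m)" if "b i j \<noteq> \<infinity>" for i j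
        using 1[OF that] by auto
      ultimately show ?thesis
        by (intro exI[of _ "\<lambda>j. x j - m"]) blast
    next
      case (2 y)
      have "minplus_less (\<lambda>j i. b i j) (\<lambda>j i. a i j) (\<lambda>i. ereal (y i))"
        unfolding minplus_less_def
      proof
        fix j
        obtain i where i: "b i j \<noteq> \<infinity>" "\<And>k. br i j + y i < an n k j + y k"
          using 2 by blast
        have "b i j + ereal (y i) < a k j + ereal (y k)" for k
        proof -
          have "b i j + ereal (y i) < ereal (an n k j) + ereal (y k)"
            using i(2)[of k] br[OF i(1)] by simp
          also have "\<dots> \<le> a k j + ereal (y k)"
            by (intro add_right_mono an_le)
          finally show ?thesis .
        qed
        then show "\<exists>i. \<forall>k. b i j + ereal (y i) < a k j + ereal (y k)" by blast
      qed
      then show ?thesis using no_y by blast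
    qed
  qed
  then obtain x where x: "\<And>n j. 0 \<le> x n j" "\<And>n. \<exists>j. x n j = (0::real)"
    "\<And>n i j. b i j \<noteq> \<infinity> \<Longrightarrow> \<exists>k. an n i k + x n k \<le> br i j + x n j"
    by metis
  obtain r l where r: "strict_mono r" and l: "\<And>j. (\<lambda>n. ereal (x (r n) j)) \<longlonglongrightarrow> l j"
    using ereal_family_convergent_subseq[of "\<lambda>n j. ereal (x n j)"] by blast
  have l_nonneg: "0 \<le> l j" for j
    by (rule LIMSEQ_le_const[OF l]) (use x(1) in auto)
  \<comment> \<open>Otherwise all coordinates would be positive at some stage, but their minimum is always 0.\<close>
  have "\<exists>j. l j \<noteq> \<infinity>"
  proof (rule ccontr)
    assume "\<nexists>j. l j \<noteq> \<infinity>"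
    then have "eventually (\<lambda>n. 0 < ereal (x (r n) j)) sequentially" for j
      by (intro order_tendstoD(1)[OF l]) auto
    then have "eventually (\<lambda>n. \<forall>j. 0 < ereal (x (r n) j)) sequentially"
      by (rule eventually_all_finite)
    then obtain n where "\<forall>j. 0 < ereal (x (r n) j)"
      using eventually_happens'[OF sequentially_bot] by blast
    moreover obtain j where "x (r n) j = 0" using x(2) by blast
    ultimately show False by (metis ereal_less(2) less_irrefl)
  qed
  then obtain j where j: "l j \<noteq> \<infinity>" by blast
  have "minplus_le a b l"
    unfolding minplus_le_def
  proof (intro allI, rule ccontr)
    fix i j assume "\<nexists>k. a i k + l k \<le> b i j + l j"
    then have less: "b i j + l j < a i k + l k" for k
      by (meson not_le)
    then have "b i j \<noteq> \<infinity>" using l_nonneg[of j] by fastforce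
    have "eventually (\<lambda>n. b i j + ereal (x (r n) j)
        < ereal (an (r n) i k) + ereal (x (r n) k)) sequentially" for k
    proof (rule eventually_less_of_tendsto_less[OF _ _ less])
      show "(\<lambda>n. b i j + ereal (x (r n) j)) \<longlonglongrightarrow> b i j + l j"
        using l_nonneg[of j] fin(2)[of i j]
        by (intro tendsto_add_ereal_general l tendsto_const) auto
      show "(\<lambda>n. ereal (an (r n) i k) + ereal (x (r n) k)) \<longlonglongrightarrow> a i k + l k"
        using l_nonneg[of k] fin(1)[of i k] LIMSEQ_subseq_LIMSEQ[OF an_lim r]
        by (intro tendsto_add_ereal_general l) (auto simp: o_def)
    qed
    then have "eventually (\<lambda>n. \<forall>k. b i j + ereal (x (r n) j)
        < ereal (an (r n) i k) + ereal (x (r n) k)) sequentially"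
      by (rule eventually_all_finite)
    then obtain n where "\<And>k. b i j + ereal (x (r n) j)
        < ereal (an (r n) i k) + ereal (x (r n) k)"
      using eventually_happens'[OF sequentially_bot] by blast
    then show False
      using x(3)[OF \<open>b i j \<noteq> \<infinity>\<close>, of "r n"] br[OF \<open>b i j \<noteq> \<infinity>\<close>]
      by (metis ereal_less_eq(3) plus_ereal.simps(1) not_le)
  qed
  moreover have "l k \<noteq> -\<infinity>" for k
    using l_nonneg[of k] by auto
  ultimately show thesis using that j by blast
qed

section \<open>Finite solutions from approximate finite solutions\<close>

text \<open>Choose solutions \<open>x n\<close> with \<open>\<epsilon>\<close> tending to \<open>0\<close> such that all differences \<open>x n u - x n v\<close> converge to
  limits \<open>L (u, v)\<close> in the extended reals. A finite limit means that \<open>u\<close> and \<open>v\<close> stay at bounded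
  distance, which partitions the coordinates into classes. Move every coordinate by an amount tending
  to \<open>0\<close> so that differences within a class are equal to their limits. Inequalities between
  coordinates of one class then hold exactly, since they hold for the limits, and those between
  different classes hold for large \<open>n\<close> with unbounded slack. As there are finitely many
  inequalities, some moved solution satisfies all of them.\<close>

lemma minplus_le_of_approx:
  fixes a b :: "'m::finite \<Rightarrow> 'n::finite \<Rightarrow> ereal"
  assumes fin: "\<And>i j. a i j \<noteq> -\<infinity>" "\<And>i j. b i j \<noteq> -\<infinity>"
    and approx: "\<And>\<epsilon>. \<epsilon> > 0 \<Longrightarrow>
      \<exists>x :: 'n \<Rightarrow> real. minplus_le a (\<lambda>i j. b i j + ereal \<epsilon>) (\<lambda>j. ereal (x j))"
  obtains x :: "'n \<Rightarrow> real" where "minplus_le a b (\<lambda>j. ereal (x j))"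
proof -
  define \<epsilon> where "\<epsilon> n = inverse (real (Suc n))" for n
  have "\<epsilon> n > 0" for n by (simp add: \<epsilon>_def)
  then have "\<exists>x :: 'n \<Rightarrow> real. minplus_le a (\<lambda>i j. b i j + ereal (\<epsilon> n)) (\<lambda>j. ereal (x j))" for n
    using approx by blast
  then obtain w :: "nat \<Rightarrow> 'n \<Rightarrow> real" where
    w: "\<And>n. minplus_le a (\<lambda>i j. b i j + ereal (\<epsilon> n)) (\<lambda>j. ereal (w n j))"
    by metis
  obtain r L where r: "strict_mono r"
    and L: "\<And>p. (\<lambda>n. case p of (u, v) \<Rightarrow> ereal (w (r n) u - w (r n) v)) \<longlonglongrightarrow> L p"
    using ereal_family_convergent_subseq[of "\<lambda>n (u, v). ereal (w n u - w n v)"] by blast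
  define x where "x n = w (r n)" for n
  have lim: "(\<lambda>n. ereal (x n u - x n v)) \<longlonglongrightarrow> L (u, v)" for u v
    using L[of "(u, v)"] by (simp add: x_def)
  have \<epsilon>_lim: "(\<lambda>n. \<epsilon> (r n)) \<longlonglongrightarrow> 0"
    using LIMSEQ_subseq_LIMSEQ[OF LIMSEQ_inverse_real_of_nat r] by (simp add: o_def \<epsilon>_def)
  define near where "near u v \<longleftrightarrow> (\<exists>c. L (u, v) = ereal c)" for u v
  have near_refl: "near u u" for u
    using LIMSEQ_unique[OF lim[of u u], of "ereal 0"] by (auto simp: near_def)
  have near_add: "L (u, v') = ereal (c + d)" if "L (u, v) = ereal c" "L (v, v') = ereal d" for u v v' c d
  proof -
    have "(\<lambda>n. (x n u - x n v) + (x n v - x n v')) \<longlonglongrightarrow> c + d"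
      using lim[of u v] lim[of v v'] that by (intro tendsto_add) auto
    then show ?thesis
      using LIMSEQ_unique[OF lim[of u v'], of "ereal (c + d)"] by simp
  qed
  have near_minus: "L (v, u) = ereal (- c)" if "L (u, v) = ereal c" for u v c
  proof -
    have "(\<lambda>n. - (x n u - x n v)) \<longlonglongrightarrow> - c"
      using lim[of u v] that by (intro tendsto_minus) auto
    then show ?thesis
      using LIMSEQ_unique[OF lim[of v u], of "ereal (- c)"] by simp
  qed
  define rep where "rep v = (SOME u. near v u)" for v
  have near_rep: "near v (rep v)" for v
    unfolding rep_def by (rule someI) (rule near_refl)
  have rep_cong: "rep u = rep v" if "near u v" for u v
  proof -
    have "near u = near v"
      using that near_add near_minus unfolding near_def fun_eq_iff by blast
    then show ?thesis by (simp add: rep_def)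
  qed
  define off where "off v = real_of_ereal (L (v, rep v))" for v
  have off: "L (v, rep v) = ereal (off v)" for v
    using near_rep[of v] by (auto simp: near_def off_def)
  define x' where "x' n v = off v + x n (rep v)" for n v
  have same_class: "x' n u - x' n v = c" if "L (u, v) = ereal c" for n u v c
  proof -
    have "rep u = rep v" using that rep_cong by (auto simp: near_def)
    moreover have "c = off u - off v"
      using near_add[OF off[of u] near_minus[OF off[of v, folded \<open>rep u = rep v\<close>]]] that by simp
    ultimately show ?thesis by (simp add: x'_def)
  qed
  have error: "(\<lambda>n. x' n v - x n v) \<longlonglongrightarrow> 0" for v
  proof -
    have "(\<lambda>n. off v - (x n v - x n (rep v))) \<longlonglongrightarrow> off v - off v"
      using lim[of v "rep v"] by (intro tendsto_diff tendsto_const) (simp add: off)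
    then show ?thesis by (simp add: x'_def algebra_simps)
  qed
  have far_below: "eventually (\<lambda>n. x' n u - x' n v < c) sequentially" if "L (u, v) = -\<infinity>" for u v c
  proof -
    have "eventually (\<lambda>n. ereal (x n u - x n v) < ereal (c - 1)) sequentially"
      using lim[of u v] that by (intro order_tendstoD(2)[where y = "-\<infinity>"]) auto
    moreover have "(\<lambda>n. (x' n u - x n u) - (x' n v - x n v)) \<longlonglongrightarrow> 0 - 0"
      by (intro tendsto_diff error)
    then have "eventually (\<lambda>n. (x' n u - x n u) - (x' n v - x n v) < 1) sequentially"
      by (intro order_tendstoD(2)) auto
    ultimately show ?thesis by eventually_elim auto
  qed
  \<comment> \<open>The index \<open>k\<close> is chosen in the limit, so one \<open>k\<close> serves all large \<open>n\<close>.\<close>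
  have "eventually (\<lambda>n. \<exists>k. a i k + ereal (x' n k) \<le> b i j + ereal (x' n j)) sequentially" for i j
  proof (cases "b i j")
    case (real \<beta>)
    have "\<exists>k \<alpha>. a i k = ereal \<alpha> \<and> ereal \<alpha> + L (k, j) \<le> ereal \<beta>"
    proof (rule ccontr)
      assume neg: "\<not> ?thesis"
      have "eventually (\<lambda>n. b i j + ereal (\<epsilon> (r n)) + ereal (x n j) < a i k + ereal (x n k)) sequentially" for k
      proof (cases "a i k")
        case (real \<alpha>)
        have "ereal \<beta> < ereal \<alpha> + L (k, j)"
          using neg real by (meson not_le)
        moreover have "(\<lambda>n. ereal \<alpha> + ereal (x n k - x n j)) \<longlonglongrightarrow> ereal \<alpha> + L (k, j)"
          by (intro tendsto_add_ereal_general lim tendsto_const) auto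
        moreover have "(\<lambda>n. \<beta> + \<epsilon> (r n)) \<longlonglongrightarrow> \<beta> + 0"
          by (intro tendsto_add tendsto_const \<epsilon>_lim)
        then have "(\<lambda>n. ereal (\<beta> + \<epsilon> (r n))) \<longlonglongrightarrow> ereal \<beta>" by simp
        ultimately have "eventually (\<lambda>n. ereal (\<beta> + \<epsilon> (r n)) < ereal \<alpha> + ereal (x n k - x n j)) sequentially"
          by (intro eventually_less_of_tendsto_less)
        then show ?thesis
          by eventually_elim (simp add: real \<open>b i j = ereal \<beta>\<close>)
      qed (use real fin(1)[of i k] in auto)
      then have "eventually (\<lambda>n. \<forall>k. b i j + ereal (\<epsilon> (r n)) + ereal (x n j) < a i k + ereal (x n k)) sequentially"
        by (rule eventually_all_finite)
      then obtain n where "\<And>k. b i j + ereal (\<epsilon> (r n)) + ereal (x n j) < a i k + ereal (x n k)"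
        using eventually_happens'[OF sequentially_bot] by blast
      then show False
        using w[of "r n"] unfolding minplus_le_def x_def by (meson not_le)
    qed
    then obtain k \<alpha> where k: "a i k = ereal \<alpha>" "ereal \<alpha> + L (k, j) \<le> ereal \<beta>" by blast
    have "eventually (\<lambda>n. \<alpha> + x' n k \<le> \<beta> + x' n j) sequentially"
    proof (cases "L (k, j)")
      case (real c)
      have "\<alpha> + x' n k \<le> \<beta> + x' n j" for n
        using same_class[OF real, of n] k(2) real by simp
      then show ?thesis by simp
    next
      case MInf
      show ?thesis
        using far_below[OF MInf, of "\<beta> - \<alpha>"] by eventually_elim simp
    qed (use k in auto)
    then show ?thesis
      by eventually_elim (use k real in \<open>auto intro!: exI[of _ k]\<close>)
  qed (use fin(2)[of i j] in auto)
  then have "eventually (\<lambda>n. \<forall>i j. \<exists>k. a i k + ereal (x' n k) \<le> b i j + ereal (x' n j)) sequentially"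
    by (intro eventually_all_finite)
  then obtain n where "\<And>i j. \<exists>k. a i k + ereal (x' n k) \<le> b i j + ereal (x' n j)"
    using eventually_happens'[OF sequentially_bot] by blast
  then show thesis
    using that[of "x' n"] by (auto simp: minplus_le_def)
qed

text \<open>The exchange of roles: a weak solution \<open>y\<close> of the transposed system for \<open>b + \<epsilon>\<close> and \<open>a\<close>
  solves the strict system for \<open>b\<close> and \<open>a\<close>, where a column with infinite smaller side has both sides
  infinite. If there is none, then \<open>weak_or_dual_strict\<close> for the transposed pair gives a finite
  strict solution \<open>x\<close> for \<open>a\<close> and \<open>b + \<epsilon>\<close>.\<close>

lemma finite_weak_or_dual_strict:
  fixes a b :: "'m::finite \<Rightarrow> 'n::finite \<Rightarrow> ereal"
  assumes fin: "\<And>i j. a i j \<noteq> -\<infinity>" "\<And>i j. b i j \<noteq> -\<infinity>"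
    and no_y: "\<nexists>y. (\<forall>i. y i \<noteq> -\<infinity>) \<and> (\<exists>i. y i \<noteq> \<infinity>) \<and> minplus_less_inf (\<lambda>j i. b i j) (\<lambda>j i. a i j) y"
  obtains x :: "'n \<Rightarrow> real" where "minplus_le a b (\<lambda>j. ereal (x j))"
proof (rule minplus_le_of_approx[OF fin])
  fix \<epsilon> :: real assume "\<epsilon> > 0"
  show "\<exists>x :: 'n \<Rightarrow> real. minplus_le a (\<lambda>i j. b i j + ereal \<epsilon>) (\<lambda>j. ereal (x j))"
  proof (rule ccontr)
    assume no_x: "\<not> ?thesis"
    have "\<nexists>x :: 'n \<Rightarrow> real. minplus_less a (\<lambda>i j. b i j + ereal \<epsilon>) (\<lambda>j. ereal (x j))"
    proof
      assume "\<exists>x :: 'n \<Rightarrow> real. minplus_less a (\<lambda>i j. b i j + ereal \<epsilon>) (\<lambda>j. ereal (x j))"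
      then obtain x :: "'n \<Rightarrow> real" where
        "minplus_less a (\<lambda>i j. b i j + ereal \<epsilon>) (\<lambda>j. ereal (x j))" by blast
      then have "minplus_le a (\<lambda>i j. b i j + ereal \<epsilon>) (\<lambda>j. ereal (x j))"
        unfolding minplus_less_def minplus_le_def by (meson less_imp_le)
      then show False using no_x by blast
    qed
    then obtain y i where y: "\<And>k. y k \<noteq> -\<infinity>" "y i \<noteq> \<infinity>"
      "minplus_le (\<lambda>j i. b i j + ereal \<epsilon>) (\<lambda>j i. a i j) y"
      using weak_or_dual_strict[of "\<lambda>j i. b i j + ereal \<epsilon>" "\<lambda>j i. a i j"] fin
      by (auto simp: ereal_plus_eq_MInfty)
    have "(\<forall>i. b i j + y i = \<infinity> \<and> a i j + y i = \<infinity>) \<or> (\<exists>i. \<forall>k. b i j + y i < a k j + y k)" for j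
    proof (cases "\<forall>i. b i j + y i = \<infinity>")
      case True
      have "a i j + y i = \<infinity>" for i
      proof -
        obtain k where "b k j + ereal \<epsilon> + y k \<le> a i j + y i"
          using y(3) by (auto simp: minplus_le_def)
        moreover have "b k j + ereal \<epsilon> + y k = \<infinity>"
          using True by auto
        ultimately show ?thesis by simp
      qed
      then show ?thesis using True by blast
    next
      case False
      define m where "m = Min (range (\<lambda>i. b i j + y i))"
      have m_le: "m \<le> b i j + y i" for i
        unfolding m_def by (rule Min_le) auto
      have "m \<in> range (\<lambda>i. b i j + y i)"
        unfolding m_def by (rule Min_in) auto
      then obtain i where i: "m = b i j + y i" by auto
      have "m \<noteq> \<infinity>" using False m_le by (metis ereal_infty_less_eq(1))
      moreover have "m \<noteq> -\<infinity>" using i fin(2) y(1) by simp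
      ultimately have "m < m + ereal \<epsilon>" using \<open>\<epsilon> > 0\<close> by (cases m) auto
      have "b i j + y i < a k j + y k" for k
      proof -
        obtain k' where "b k' j + ereal \<epsilon> + y k' \<le> a k j + y k"
          using y(3) by (auto simp: minplus_le_def)
        moreover have "m + ereal \<epsilon> \<le> b k' j + ereal \<epsilon> + y k'"
          using add_right_mono[OF m_le[of k'], of "ereal \<epsilon>"] by (simp add: ac_simps)
        ultimately show ?thesis
          using \<open>m < m + ereal \<epsilon>\<close> i by order
      qed
      then show ?thesis by blast
    qed
    then have "minplus_less_inf (\<lambda>j i. b i j) (\<lambda>j i. a i j) y"
      by (simp add: minplus_less_inf_def)
    then show False using no_y y by blast
  qed
qed (rule that)

section \<open>The theorem of alternatives\<close>

lemma R_inf_iff: "r \<in> R_inf \<longleftrightarrow> r \<noteq> -\<infinity>"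
  by (cases r) (auto simp: R_inf_def)

theorem corollary13:
  shows
  "(\<forall>A B :: real ^ 'n ^ 'm.
      (\<exists>x :: real ^ 'n. A \<odot> x \<le> B \<odot> x)
      \<longleftrightarrow> \<not> (\<exists>y :: real ^ 'm. vec_less (transpose B \<odot> y) (transpose A \<odot> y)))
   \<and>
   (\<forall>A \<in> R_inf_mat. \<forall>B \<in> (R_inf_mat :: (ereal ^ 'n ^ 'm) set).
      no_common_inf_row A B \<and> no_common_inf_column A B \<longrightarrow>
      ((\<exists>x \<in> R_inf_vec. x \<noteq> inf_vec \<and> A \<odot> x \<le> B \<odot> x)
       \<longleftrightarrow> \<not> (\<exists>y :: real ^ 'm.
              vec_less_inf (transpose B \<odot> ereal_vec y) (transpose A \<odot> ereal_vec y))))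
   \<and>
   (\<forall>A \<in> R_inf_mat. \<forall>B \<in> (R_inf_mat :: (ereal ^ 'n ^ 'm) set).
      no_common_inf_row A B \<and> no_common_inf_column A B \<longrightarrow>
      ((\<exists>x :: real ^ 'n. A \<odot> ereal_vec x \<le> B \<odot> ereal_vec x)
       \<longleftrightarrow> \<not> (\<exists>y \<in> R_inf_vec. y \<noteq> inf_vec
              \<and> vec_less_inf (transpose B \<odot> y) (transpose A \<odot> y))))"
proof (intro conjI allI ballI impI; (elim conjE)?)
  fix A B :: "real ^ 'n ^ 'm"
  let ?a = "\<lambda>i j. A $ i $ j" and ?b = "\<lambda>i j. B $ i $ j"
  have transpose: "vec_less (transpose B \<odot> y) (transpose A \<odot> y) \<longleftrightarrow>
      minplus_less (\<lambda>j i. ?b i j) (\<lambda>j i. ?a i j) (\<lambda>i. y $ i)" for y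
    by (simp add: vec_less_trop_mult_iff transpose_def)
  show "(\<exists>x. A \<odot> x \<le> B \<odot> x)
      \<longleftrightarrow> \<not> (\<exists>y. vec_less (transpose B \<odot> y) (transpose A \<odot> y))"
  proof
    assume "\<exists>x. A \<odot> x \<le> B \<odot> x"
    then obtain x where x: "minplus_le ?a ?b (\<lambda>j. x $ j)"
      by (auto simp: trop_mult_le_iff)
    show "\<not> (\<exists>y. vec_less (transpose B \<odot> y) (transpose A \<odot> y))"
    proof
      assume "\<exists>y. vec_less (transpose B \<odot> y) (transpose A \<odot> y)"
      then obtain y where y: "minplus_less (\<lambda>j i. ?b i j) (\<lambda>j i. ?a i j) (\<lambda>i. y $ i)"
        by (auto simp: transpose)
      have "minplus_le (\<lambda>i j. ereal (?a i j)) (\<lambda>i j. ereal (?b i j)) (\<lambda>j. ereal (x $ j))"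
        using x by (simp add: minplus_le_def)
      moreover have "minplus_less_inf (\<lambda>j i. ereal (?b i j)) (\<lambda>j i. ereal (?a i j)) (\<lambda>i. ereal (y $ i))"
        using y by (simp add: minplus_less_def minplus_less_inf_def)
      ultimately have "ereal (?b i j) + ereal (x $ j) + ereal (y $ i) = \<infinity>" for i j
        by (rule weak_and_dual_strict_imp_infinite) auto
      then show False by simp
    qed
  next
    assume no_y: "\<not> (\<exists>y. vec_less (transpose B \<odot> y) (transpose A \<odot> y))"
    have "(\<exists>x. minplus_le ?a ?b x) \<or> (\<exists>y. minplus_less (\<lambda>j i. ?b i j) (\<lambda>j i. ?a i j) y)"
      using finite_alternative[of "\<lambda>_. UNIV" ?a ?b] by (simp add: minplus_le_def minplus_less_def)
    then consider x where "minplus_le ?a ?b x"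
      | y where "minplus_less (\<lambda>j i. ?b i j) (\<lambda>j i. ?a i j) y"
      by blast
    then show "\<exists>x. A \<odot> x \<le> B \<odot> x"
    proof cases
      case (1 x)
      then have "A \<odot> (\<chi> j. x j) \<le> B \<odot> (\<chi> j. x j)"
        by (simp add: trop_mult_le_iff)
      then show ?thesis by blast
    next
      case (2 y)
      then have "vec_less (transpose B \<odot> (\<chi> i. y i)) (transpose A \<odot> (\<chi> i. y i))"
        by (simp add: transpose)
      then show ?thesis using no_y by blast
    qed
  qed
next
  fix A B :: "ereal ^ 'n ^ 'm"
  assume "A \<in> R_inf_mat" "B \<in> R_inf_mat" and col: "no_common_inf_column A B"
  let ?a = "\<lambda>i j. A $ i $ j" and ?b = "\<lambda>i j. B $ i $ j"
  have fin: "?a i j \<noteq> -\<infinity>" "?b i j \<noteq> -\<infinity>" for i j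
    using \<open>A \<in> R_inf_mat\<close> \<open>B \<in> R_inf_mat\<close> by (auto simp: R_inf_mat_def R_inf_iff)
  have transpose: "vec_less_inf (transpose B \<odot> y) (transpose A \<odot> y) \<longleftrightarrow>
      minplus_less_inf (\<lambda>j i. ?b i j) (\<lambda>j i. ?a i j) (\<lambda>i. y $ i)" for y
    by (simp add: vec_less_inf_trop_mult_iff transpose_def)
  show "(\<exists>x \<in> R_inf_vec. x \<noteq> inf_vec \<and> A \<odot> x \<le> B \<odot> x)
      \<longleftrightarrow> \<not> (\<exists>y. vec_less_inf (transpose B \<odot> ereal_vec y) (transpose A \<odot> ereal_vec y))"
  proof
    assume "\<exists>x \<in> R_inf_vec. x \<noteq> inf_vec \<and> A \<odot> x \<le> B \<odot> x"
    then obtain x where x: "\<And>j. x $ j \<noteq> -\<infinity>" "x \<noteq> inf_vec" "minplus_le ?a ?b (\<lambda>j. x $ j)"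
      by (auto simp: R_inf_vec_def R_inf_iff trop_mult_le_iff)
    obtain j where j: "x $ j \<noteq> \<infinity>"
      using x(2) by (auto simp: inf_vec_def vec_eq_iff)
    show "\<not> (\<exists>y. vec_less_inf (transpose B \<odot> ereal_vec y) (transpose A \<odot> ereal_vec y))"
    proof
      assume "\<exists>y. vec_less_inf (transpose B \<odot> ereal_vec y) (transpose A \<odot> ereal_vec y)"
      then obtain y where y: "minplus_less_inf (\<lambda>j i. ?b i j) (\<lambda>j i. ?a i j) (\<lambda>i. ereal (y $ i))"
        by (auto simp: transpose ereal_vec_def)
      have "?b i j + x $ j + ereal (y $ i) = \<infinity>" for i
        by (rule weak_and_dual_strict_imp_infinite[OF x(3) y]) (use fin x(1) in auto)
      then have b: "?b i j = \<infinity>" for i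
        using j by auto
      have "?a i j = \<infinity>" for i
        using y[unfolded minplus_less_inf_def, rule_format, of j] unfolding b by auto
      then show False
        using b col unfolding no_common_inf_column_def by blast
    qed
  next
    assume no_y: "\<not> (\<exists>y. vec_less_inf (transpose B \<odot> ereal_vec y) (transpose A \<odot> ereal_vec y))"
    have "\<nexists>y. minplus_less (\<lambda>j i. ?b i j) (\<lambda>j i. ?a i j) (\<lambda>i. ereal (y i))"
    proof
      assume "\<exists>y. minplus_less (\<lambda>j i. ?b i j) (\<lambda>j i. ?a i j) (\<lambda>i. ereal (y i))"
      then obtain y where "minplus_less (\<lambda>j i. ?b i j) (\<lambda>j i. ?a i j) (\<lambda>i. ereal (y i))"
        by blast
      then have "vec_less_inf (transpose B \<odot> ereal_vec (\<chi> i. y i)) (transpose A \<odot> ereal_vec (\<chi> i. y i))"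
        by (simp add: transpose ereal_vec_def minplus_less_def minplus_less_inf_def)
      then show False using no_y by blast
    qed
    then obtain x j where x: "\<And>k. x k \<noteq> -\<infinity>" "x j \<noteq> \<infinity>" "minplus_le ?a ?b x"
      using weak_or_dual_strict[of ?a ?b] fin by blast
    have "(\<chi> j. x j) \<in> R_inf_vec" "(\<chi> j. x j) \<noteq> inf_vec" "A \<odot> (\<chi> j. x j) \<le> B \<odot> (\<chi> j. x j)"
      using x by (auto simp: R_inf_vec_def R_inf_iff inf_vec_def vec_eq_iff trop_mult_le_iff)
    then show "\<exists>x \<in> R_inf_vec. x \<noteq> inf_vec \<and> A \<odot> x \<le> B \<odot> x" by blast
  qed
next
  fix A B :: "ereal ^ 'n ^ 'm"
  assume "A \<in> R_inf_mat" "B \<in> R_inf_mat" and row: "no_common_inf_row A B"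
  let ?a = "\<lambda>i j. A $ i $ j" and ?b = "\<lambda>i j. B $ i $ j"
  have fin: "?a i j \<noteq> -\<infinity>" "?b i j \<noteq> -\<infinity>" for i j
    using \<open>A \<in> R_inf_mat\<close> \<open>B \<in> R_inf_mat\<close> by (auto simp: R_inf_mat_def R_inf_iff)
  have transpose: "vec_less_inf (transpose B \<odot> y) (transpose A \<odot> y) \<longleftrightarrow>
      minplus_less_inf (\<lambda>j i. ?b i j) (\<lambda>j i. ?a i j) (\<lambda>i. y $ i)" for y
    by (simp add: vec_less_inf_trop_mult_iff transpose_def)
  show "(\<exists>x. A \<odot> ereal_vec x \<le> B \<odot> ereal_vec x)
      \<longleftrightarrow> \<not> (\<exists>y \<in> R_inf_vec. y \<noteq> inf_vec
            \<and> vec_less_inf (transpose B \<odot> y) (transpose A \<odot> y))"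
  proof
    assume "\<exists>x. A \<odot> ereal_vec x \<le> B \<odot> ereal_vec x"
    then obtain x where x: "minplus_le ?a ?b (\<lambda>j. ereal (x $ j))"
      by (auto simp: trop_mult_le_iff ereal_vec_def)
    show "\<not> (\<exists>y \<in> R_inf_vec. y \<noteq> inf_vec \<and> vec_less_inf (transpose B \<odot> y) (transpose A \<odot> y))"
    proof
      assume "\<exists>y \<in> R_inf_vec. y \<noteq> inf_vec \<and> vec_less_inf (transpose B \<odot> y) (transpose A \<odot> y)"
      then obtain y where y: "\<And>i. y $ i \<noteq> -\<infinity>" "y \<noteq> inf_vec"
        "minplus_less_inf (\<lambda>j i. ?b i j) (\<lambda>j i. ?a i j) (\<lambda>i. y $ i)"
        by (auto simp: R_inf_vec_def R_inf_iff transpose)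
      obtain i where i: "y $ i \<noteq> \<infinity>"
        using y(2) by (auto simp: inf_vec_def vec_eq_iff)
      have inf: "?b i j + ereal (x $ j) + y $ i = \<infinity>" for i j
        by (rule weak_and_dual_strict_imp_infinite[OF x y(3)]) (use fin y(1) in auto)
      have b: "?b i j + y $ i = \<infinity>" for i j
        using inf[of i j] by auto
      have "?a i j + y $ i = \<infinity>" for j
        using y(3)[unfolded minplus_less_inf_def, rule_format, of j] unfolding b by auto
      then have "?a i j = \<infinity>" "?b i j = \<infinity>" for j
        using i inf[of i j] by auto
      then show False
        using row unfolding no_common_inf_row_def by blast
    qed
  next
    assume no_y: "\<not> (\<exists>y \<in> R_inf_vec. y \<noteq> inf_vec
        \<and> vec_less_inf (transpose B \<odot> y) (transpose A \<odot> y))"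
    have "\<nexists>y. (\<forall>i. y i \<noteq> -\<infinity>) \<and> (\<exists>i. y i \<noteq> \<infinity>) \<and>
        minplus_less_inf (\<lambda>j i. ?b i j) (\<lambda>j i. ?a i j) y"
    proof clarify
      fix y i
      assume y: "\<forall>i. y i \<noteq> -\<infinity>" "y i \<noteq> \<infinity>" "minplus_less_inf (\<lambda>j i. ?b i j) (\<lambda>j i. ?a i j) y"
      have "(\<chi> i. y i) \<in> R_inf_vec" "(\<chi> i. y i) \<noteq> inf_vec"
        "vec_less_inf (transpose B \<odot> (\<chi> i. y i)) (transpose A \<odot> (\<chi> i. y i))"
        using y by (auto simp: R_inf_vec_def R_inf_iff inf_vec_def vec_eq_iff transpose)
      then show False using no_y by blast
    qed
    then obtain x where "minplus_le ?a ?b (\<lambda>j. ereal (x j))"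
      using finite_weak_or_dual_strict[of ?a ?b] fin by blast
    then have "A \<odot> ereal_vec (\<chi> j. x j) \<le> B \<odot> ereal_vec (\<chi> j. x j)"
      by (simp add: trop_mult_le_iff ereal_vec_def)
    then show "\<exists>x. A \<odot> ereal_vec x \<le> B \<odot> ereal_vec x" by blast
  qed
qed

end
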